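(* Let $p,q\geqslant 0$ be integers with $q\neq p+1$. The set of critical values of $\delta$ for the $\mathfrak{sl}(p+1|q)$-equivariant quantization over $\mathbb{R}^{p|q}$ is $$\mathfrak{C}=\bigcup_{k=1}^\infty\mathfrak{C}_k,\qquad\text{where}\qquad \mathfrak{C}_k=\left\{\frac{2k-l+p-q}{p-q+1}\colon l=1,\ldots,k\right\}.$$
   Context: For integers $p,q\geqslant 0$ with $q\neq p+1$, $k\in\mathbb{N}=\{0,1,2,\ldots\}$ and $\delta\in\mathbb{R}$, set $$\alpha(k,\delta)=\frac{p-q}{2}\delta^2-\frac{2k+p-q}{2}\delta+\frac{k(k+(p-q))}{p-q+1}$$ (this is the eigenvalue of the Casimir operator of $\mathfrak{pgl}(p+1|q)\cong\mathfrak{sl}(p+1|q)$ on symmetric tensor fields of degree $k$ and weight $\delta$ over $\mathbb{R}^{p|q}$). A value $\delta\in\mathbb{R}$ is called critical if there exist $k,l\in\mathbb{N}$ with $l<k$ such that $\alpha(k,\delta)=\alpha(l,\delta)$. *)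

theory Defs
  imports Complex_Main
begin

text \<open>
  \<^term>\<open>casimir_eigenvalue p q k \<delta>\<close> is the eigenvalue of the Casimir operator of
  \<open>sl(p+1|q)\<close> on symmetric tensor fields of degree \<open>k\<close> and weight \<open>\<delta>\<close> over \<open>\<real>\<^bsup>p|q\<^esup>\<close>,
  taken here as given by its explicit formula. It is only meaningful for \<open>q \<noteq> p + 1\<close>, since
  otherwise the last denominator vanishes.
\<close>

definition casimir_eigenvalue :: "nat \<Rightarrow> nat \<Rightarrow> nat \<Rightarrow> real \<Rightarrow> real" where
  "casimir_eigenvalue p q k \<delta> =
     (real p - real q) / 2 * \<delta>\<^sup>2
     - (2 * real k + real p - real q) / 2 * \<delta>
     + real k * (real k + (real p - real q)) / (real p - real q + 1)"

definition critical :: "nat \<Rightarrow> nat \<Rightarrow> real \<Rightarrow> bool" where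
  "critical p q \<delta> \<longleftrightarrow>
     (\<exists>k l :: nat. l < k \<and> casimir_eigenvalue p q k \<delta> = casimir_eigenvalue p q l \<delta>)"

definition critical_values_of_degree :: "nat \<Rightarrow> nat \<Rightarrow> nat \<Rightarrow> real set" where
  "critical_values_of_degree p q k =
     {(2 * real k - real l + real p - real q) / (real p - real q + 1) | l :: nat. l \<in> {1..k}}"

end

theory Submission
  imports Defs
begin

text \<open>
  The quadratic part of the eigenvalue in the weight does not depend on the degree, so the difference
  of the eigenvalues in degrees \<open>k\<close> and \<open>l\<close> is \<open>k - l\<close> times an affine function of \<open>\<delta>\<close>, whose only
  zero is \<open>(k + l + p - q) / (p - q + 1)\<close>. Replacing \<open>l\<close> by \<open>k - l\<close> gives the listed values.
\<close>

lemma casimir_eigenvalue_diff: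
  "casimir_eigenvalue p q k \<delta> - casimir_eigenvalue p q l \<delta> =
     (real k - real l) * ((real k + real l + real p - real q) / (real p - real q + 1) - \<delta>)"
proof -
  have "real k * (real k + (real p - real q)) - real l * (real l + (real p - real q)) =
      (real k - real l) * (real k + real l + real p - real q)"
    by (simp add: algebra_simps)
  \<comment> \<open>The common denominator is factored out and never cancelled; with
    \<open>x / 0 = 0\<close> this is valid for every value of it.\<close>
  then have "real k * (real k + (real p - real q)) / (real p - real q + 1)
      - real l * (real l + (real p - real q)) / (real p - real q + 1) =
      (real k - real l) * ((real k + real l + real p - real q) / (real p - real q + 1))"
    by (simp flip: diff_divide_distrib)
  then show ?thesis
    unfolding casimir_eigenvalue_def by (simp add: field_simps)
qed

text \<open>For distinct degrees the factor \<open>real k - real l\<close> is nonzero and cancels,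
  leaving the affine factor.\<close>

lemma casimir_eigenvalue_eq_iff:
  assumes "l \<noteq> k"
  shows "casimir_eigenvalue p q k \<delta> = casimir_eigenvalue p q l \<delta> \<longleftrightarrow>
    \<delta> = (real k + real l + real p - real q) / (real p - real q + 1)"
  using casimir_eigenvalue_diff[of p q k \<delta> l] assms by auto

text \<open>Reindexes the listed values as zeros of the affine factor, with the range
  \<open>l < k\<close> that \<open>critical\<close> uses.\<close>

lemma critical_values_of_degree_eq:
  "critical_values_of_degree p q k =
     (\<lambda>l. (real k + real l + real p - real q) / (real p - real q + 1)) ` {..<k}"
proof -
  have "{1..k} = (\<lambda>l. k - l) ` {..<k}"
  proof
    show "{1..k} \<subseteq> (\<lambda>l. k - l) ` {..<k}"
    proof
      fix l assume "l \<in> {1..k}"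
      then show "l \<in> (\<lambda>l. k - l) ` {..<k}"
        \<comment> \<open>Reflection is its own inverse: \<open>l \<le> k\<close> gives
          \<open>k - (k - l) = l\<close> despite truncation, and \<open>l \<ge> 1\<close> gives
          \<open>k - l < k\<close>.\<close>
        by (intro image_eqI[of _ _ "k - l"]) auto
    qed
  qed auto
  moreover have "critical_values_of_degree p q k =
      (\<lambda>l. (2 * real k - real l + real p - real q) / (real p - real q + 1)) ` {1..k}"
    unfolding critical_values_of_degree_def by auto
  ultimately show ?thesis
    by (simp add: image_image of_nat_diff cong: image_cong_simp)
qed

theorem proposition4p1p2:
  fixes p q :: nat
  assumes "q \<noteq> p + 1"
  shows "{\<delta> :: real. critical p q \<delta>} = (\<Union>k\<in>{1..}. critical_values_of_degree p q k)"
proof (intro set_eqI iffI)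
  fix \<delta> :: real
  assume "\<delta> \<in> {\<delta>. critical p q \<delta>}"
  then obtain k l where "l < k" "casimir_eigenvalue p q k \<delta> = casimir_eigenvalue p q l \<delta>"
    by (auto simp: critical_def)
  \<comment> \<open>The larger degree of the pair is the index of the set; it is positive because it
    exceeds \<open>l\<close>.\<close>
  then have "\<delta> \<in> critical_values_of_degree p q k" "k \<in> {1..}"
    by (auto simp: casimir_eigenvalue_eq_iff critical_values_of_degree_eq)
  then show "\<delta> \<in> (\<Union>k\<in>{1..}. critical_values_of_degree p q k)"
    by blast
next
  fix \<delta> :: real
  assume "\<delta> \<in> (\<Union>k\<in>{1..}. critical_values_of_degree p q k)"
  then obtain k l where "l < k"
    "\<delta> = (real k + real l + real p - real q) / (real p - real q + 1)"
    by (auto simp: critical_values_of_degree_eq)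
  then show "\<delta> \<in> {\<delta>. critical p q \<delta>}"
    using casimir_eigenvalue_eq_iff[of l k p q \<delta>] by (auto simp: critical_def)
qed

end
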